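(* If the dimension $d$ is odd, there is no nonempty open subset $\Omega\subseteq M_{d\times d}$ on which the ODE system $D\mathbf{x}(t)=A\mathbf{x}(t)$, $\mathbf{x}(0)=\mathbf{x}_0$, is unconditionally identifiable. If the dimension $d$ is even, then for every $\Omega\subseteq M_{d\times d}$ such that $\lambda(M_{d\times d}\setminus\Omega)=0$, the system is not unconditionally identifiable in $\Omega$.
   Context: $M_{d\times d}$ is the set of real $d\times d$ matrices (identified with $\mathbb{R}^{d^2}$), $\lambda$ is Lebesgue measure on $M_{d\times d}$, $D=\frac{d}{dt}$, $T>0$ is fixed, and $\mathbf{x}(t|A,\mathbf{x}_0)=e^{tA}\mathbf{x}_0$. Unconditional identifiability: the system is unconditionally identifiable in $\Omega\subseteq M_{d\times d}$ iff for all $A,B\in\Omega$, $A\neq B$ implies that for each nonzero $\mathbf{x}_0\in\mathbb{R}^d$, $\mathbf{x}(t|A,\mathbf{x}_0)\neq\mathbf{x}(t|B,\mathbf{x}_0)$ for some $0<t<T$.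
   Formalization: The dimension d = 1 is excluded: there e^{ta}x_0 = e^{tb}x_0 with x_0 ≠ 0 and t > 0 forces a = b, so the scalar system is unconditionally identifiable on the nonempty open set of all real numbers and the odd-dimension claim fails; it is proved for odd d ≥ 3. *)

theory Defs
  imports "HOL-Analysis.Analysis"
begin

text \<open>
  The type \<open>real^'n^'n\<close> is not an instance of \<open>real_normed_algebra_1\<close> (its multiplication
  \<open>*\<close> is componentwise), so neither \<open>^\<close> nor the library function \<open>exp\<close> can be used for the
  matrix power and the matrix exponential.
\<close>

primrec mat_pow :: "real^'n^'n \<Rightarrow> nat \<Rightarrow> real^'n^'n" where
  "mat_pow A 0 = mat 1"
| "mat_pow A (Suc k) = A ** mat_pow A k"

definition mat_exp :: "real^'n^'n \<Rightarrow> real^'n^'n" where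
  "mat_exp A = (\<Sum>k. inverse (fact k) *\<^sub>R mat_pow A k)"

text \<open>The solution of \<open>D x(t) = A x(t)\<close>, \<open>x(0) = x0\<close>.\<close>

definition ode_sol :: "real^'n^'n \<Rightarrow> real^'n \<Rightarrow> real \<Rightarrow> real^'n" where
  "ode_sol A x0 t = mat_exp (t *\<^sub>R A) *v x0"

definition unconditionally_identifiable :: "real \<Rightarrow> (real^'n^'n) set \<Rightarrow> bool" where
  "unconditionally_identifiable T \<Omega> \<longleftrightarrow>
     (\<forall>A\<in>\<Omega>. \<forall>B\<in>\<Omega>. A \<noteq> B \<longrightarrow>
        (\<forall>x0. x0 \<noteq> 0 \<longrightarrow> (\<exists>t. 0 < t \<and> t < T \<and> ode_sol A x0 t \<noteq> ode_sol B x0 t)))"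

text \<open>
  In dimension one, \<open>exp (t * a) * x0 = exp (t * b) * x0\<close> with \<open>t > 0\<close> and \<open>x0 \<noteq> 0\<close> forces
  \<open>a = b\<close>, so there every \<open>\<Omega>\<close> is unconditionally identifiable whenever \<open>T > 0\<close>;
  non-identifiability can only be claimed for \<open>CARD('n) \<noteq> 1\<close>.
\<close>

end

theory Submission
  imports Defs
begin

text \<open>
  If two different matrices \<open>A\<close>, \<open>B\<close> share an eigenvector \<open>v\<close> with the same eigenvalue \<open>c\<close>, then the
  solutions started at \<open>v\<close> are both \<open>exp (t * c) *\<^sub>R v\<close>, so \<open>A\<close> and \<open>B\<close> cannot be told apart from
  \<open>v\<close> (\<open>common_eigenpair_not_identifiable\<close>). It remains to find such a pair in \<open>\<Omega>\<close>.

  In odd dimension every matrix \<open>A\<close> has a real eigenvector \<open>v\<close>. In dimension at least two there is a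
  nonzero \<open>w\<close> orthogonal to \<open>v\<close>, and adding a small multiple of the rank-one matrix \<open>v w\<^sup>T\<close>,
  which kills \<open>v\<close>, stays in the open set \<open>\<Omega>\<close> (\<open>open_common_eigenpair\<close>).

  For a conull \<open>\<Omega>\<close> a fixed perturbation of a fixed matrix is useless, since the matrices with a
  prescribed eigenvector form a null set. Instead, matrices with a real eigenvector are
  parametrised: \<open>eigen_param p\<close> is a quadratic map on the space of matrices for which column \<open>p\<close> of
  the parameter alone fixes an eigenvector and its eigenvalue, while the remaining columns are free.
  Near \<open>0\<close> it is a translation plus a contraction, hence expands distances up to a constant factor,
  and so the preimage of a null set is null (\<open>negligible_expanding_vimage\<close>). Null sets being
  translation invariant, some parameter \<open>H\<close> and its translate \<open>H + D\<close>, with \<open>D\<close> vanishing on column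
  \<open>p\<close>, both avoid the bad set; their images are two matrices in \<open>\<Omega>\<close> with a common eigenpair
  (\<open>conull_common_eigenpair\<close>).
\<close>

section \<open>Solutions along eigenvectors\<close>

lemma mat_pow_eigen:
  assumes "A *v v = c *\<^sub>R v"
  shows "mat_pow A k *v v = c ^ k *\<^sub>R v"
  using assms
  by (induction k) (simp_all add: matrix_vector_mul_assoc [symmetric] matrix_vector_mult_scaleR)

lemma bounded_bilinear_matrix_mult:
  "bounded_bilinear ((**) :: real^'n^'n \<Rightarrow> real^'n^'n \<Rightarrow> real^'n^'n)"
  unfolding bilinear_conv_bounded_bilinear [symmetric] bilinear_def
  by (auto intro!: linearI simp: matrix_matrix_mult_def vec_eq_iff sum.distrib sum_distrib_left algebra_simps)

text \<open>
  Convergence of the series has to come from submultiplicativity up to a constant \<open>K\<close>,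
  which holds for any norm on a finite-dimensional algebra. It is what allows the
  exponential to be applied to a vector term by term.
\<close>
lemma summable_mat_exp:
  fixes A :: "real^'n^'n"
  shows "summable (\<lambda>k. inverse (fact k) *\<^sub>R mat_pow A k)"
proof -
  obtain K where "K \<ge> 0" and K: "\<And>(X :: real^'n^'n) (Y :: real^'n^'n). norm (X ** Y) \<le> norm X * norm Y * K"
    using bounded_bilinear.nonneg_bounded [OF bounded_bilinear_matrix_mult [where 'n = 'n]] by blast
  define C where "C = norm (mat 1 :: real^'n^'n)"
  have bound: "norm (mat_pow A k) \<le> C * (norm A * K) ^ k" for k
  proof (induction k)
    case (Suc k)
    have "norm (mat_pow A (Suc k)) \<le> norm A * norm (mat_pow A k) * K"
      by (simp add: K)
    also have "\<dots> \<le> norm A * (C * (norm A * K) ^ k) * K"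
      using Suc \<open>K \<ge> 0\<close> by (intro mult_right_mono mult_left_mono) auto
    finally show ?case by (simp add: mult_ac)
  qed (simp add: C_def)
  have "summable (\<lambda>k. C * (inverse (fact k) * (norm A * K) ^ k))"
    by (intro summable_mult summable_exp)
  then show ?thesis
  proof (rule summable_comparison_test')
    show "norm (inverse (fact k) *\<^sub>R mat_pow A k)
        \<le> C * (inverse (fact k) * (norm A * K) ^ k)" if "k \<ge> 0" for k
      using mult_left_mono [OF bound [of k], of "inverse (fact k)"] by (simp add: mult_ac)
  qed
qed

lemma mat_exp_eigen:
  fixes A :: "real^'n^'n"
  assumes "A *v v = c *\<^sub>R v"
  shows "mat_exp A *v v = exp c *\<^sub>R v"
proof -
  have "bounded_linear (\<lambda>X :: real^'n^'n. X *v v)"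
    by (intro linear_conv_bounded_linear [THEN iffD1] linearI)
       (simp_all add: matrix_vector_mult_add_rdistrib scaleR_matrix_vector_assoc)
  then have "mat_exp A *v v = (\<Sum>k. (inverse (fact k) *\<^sub>R mat_pow A k) *v v)"
    unfolding mat_exp_def by (rule bounded_linear.suminf [OF _ summable_mat_exp])
  also have "\<dots> = (\<Sum>k. (c ^ k /\<^sub>R fact k) *\<^sub>R v)"
    by (simp add: scaleR_matrix_vector_assoc [symmetric] mat_pow_eigen [OF assms])
  also have "\<dots> = exp c *\<^sub>R v"
    unfolding exp_def by (rule bounded_linear.suminf [OF bounded_linear_scaleR_left, symmetric])
      (rule summable_exp_generic)
  finally show ?thesis .
qed

lemma ode_sol_eigen:
  assumes "A *v v = c *\<^sub>R v"
  shows "ode_sol A v t = exp (t * c) *\<^sub>R v"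
  unfolding ode_sol_def
  by (rule mat_exp_eigen) (simp add: scaleR_matrix_vector_assoc [symmetric] assms)

lemma common_eigenpair_not_identifiable:
  assumes "A \<in> \<Omega>" "B \<in> \<Omega>" "A \<noteq> B" "v \<noteq> 0" "A *v v = c *\<^sub>R v" "B *v v = c *\<^sub>R v"
  shows "\<not> unconditionally_identifiable T \<Omega>"
  using assms unfolding unconditionally_identifiable_def by (metis ode_sol_eigen)

section \<open>Odd dimension\<close>

definition outer_prod :: "real^'n \<Rightarrow> real^'n \<Rightarrow> real^'n^'n" where
  "outer_prod u w = (\<chi> i j. u $ i * w $ j)"

lemma outer_prod_mult_vec: "outer_prod u w *v x = (w \<bullet> x) *\<^sub>R u"
  by (simp add: outer_prod_def matrix_vector_mult_def vec_eq_iff inner_vec_def sum_distrib_left mult_ac)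

lemma outer_prod_scaleR: "outer_prod (c *\<^sub>R u) w = c *\<^sub>R outer_prod u w"
  by (simp add: outer_prod_def vec_eq_iff)

lemma outer_prod_add: "outer_prod (u + u') w = outer_prod u w + outer_prod u' w"
  by (simp add: outer_prod_def vec_eq_iff algebra_simps)

lemma outer_prod_eq_0_iff: "outer_prod u w = 0 \<longleftrightarrow> u = 0 \<or> w = 0"
  by (auto simp: outer_prod_def vec_eq_iff)

lemma det_scaleR:
  fixes A :: "real^'n^'n"
  shows "det (c *\<^sub>R A) = c ^ CARD('n) * det A"
proof -
  have "c *\<^sub>R A = (\<chi> i. c *s A $ i)"
    by (simp add: vec_eq_iff)
  then show ?thesis
    using det_rows_mul [of "\<lambda>_. c" "\<lambda>i. A $ i"] by simp
qed

text \<open>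
  The intermediate value theorem for the characteristic polynomial. Its signs at plus and minus
  infinity are read off from \<open>g s = det (s A - 1)\<close>, which is negative near \<open>s = 0\<close> because
  \<open>g 0 = -1\<close>: with \<open>t = 1 / s\<close>, \<open>det (A - t) = t\<^sup>d g s\<close> for the odd dimension \<open>d\<close>.
\<close>
lemma odd_dim_eigenvector:
  fixes A :: "real^'n^'n"
  assumes "odd CARD('n)"
  obtains c v where "v \<noteq> 0" "A *v v = c *\<^sub>R v"
proof -
  define g where "g s = det (s *\<^sub>R A - mat 1)" for s
  define h where "h t = det (A - t *\<^sub>R mat 1)" for t
  have cont: "continuous_on UNIV g" "continuous_on UNIV h"
    unfolding g_def h_def det_def by (auto intro!: continuous_intros)
  have hg: "h (inverse s) = inverse s ^ CARD('n) * g s" if "s \<noteq> 0" for s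
  proof -
    have "A - inverse s *\<^sub>R mat 1 = inverse s *\<^sub>R (s *\<^sub>R A - mat 1)"
      using that by (simp add: algebra_simps)
    then show ?thesis
      by (simp only: h_def g_def det_scaleR)
  qed
  have "g 0 = (-1) ^ CARD('n)"
    using det_scaleR [of "-1" "mat 1 :: real^'n^'n"] by (simp add: g_def)
  then have "g 0 < 0" using assms by simp
  moreover have "(g \<longlongrightarrow> g 0) (at 0)"
    using cont(1) by (simp add: continuous_on_def)
  ultimately have "\<forall>\<^sub>F s in at 0. g s < 0"
    by (intro order_tendstoD(2))
  then obtain d where "d > 0" and d: "\<And>s. s \<noteq> 0 \<Longrightarrow> dist s 0 < d \<Longrightarrow> g s < 0"
    unfolding eventually_at by auto
  define s where "s = d / 2"
  have "s > 0" "g s < 0" "g (- s) < 0"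
    using \<open>d > 0\<close> by (auto simp: s_def intro!: d)
  moreover have "(- inverse s) ^ CARD('n) = - (inverse s ^ CARD('n))"
    using assms by simp
  ultimately have "h (inverse s) \<le> 0" "0 \<le> h (- inverse s)" "- inverse s \<le> inverse s"
    using hg [of s] hg [of "- s"] by (auto simp: mult_nonneg_nonpos)
  then obtain c where "h c = 0"
    using IVT2' [of h "inverse s" 0 "- inverse s"] continuous_on_subset [OF cont(2)] by auto
  then have "\<not> invertible (A - c *\<^sub>R mat 1)"
    by (simp add: h_def invertible_det_nz)
  then obtain v where "v \<noteq> 0" "(A - c *\<^sub>R mat 1) *v v = 0"
    by (metis invertible_left_inverse matrix_left_invertible_ker)
  then show thesis
    by (intro that [of v c])
       (auto simp: matrix_vector_mult_diff_rdistrib scaleR_matrix_vector_assoc [symmetric])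
qed

lemma exists_nonzero_orthogonal:
  fixes v :: "real^'n"
  assumes "CARD('n) \<noteq> 1"
  obtains w where "w \<noteq> 0" "w \<bullet> v = 0"
proof -
  have "1 < DIM(real^'n)" using assms by (simp add: Suc_lessI)
  then obtain w where "w \<noteq> 0" "orthogonal v w"
    using orthogonal_to_vector_exists[of v] by auto
  then show thesis by (intro that [of w]) (auto simp: orthogonal_def inner_commute)
qed

lemma open_common_eigenpair:
  fixes \<Omega> :: "(real^'n^'n) set"
  assumes "odd CARD('n)" "CARD('n) \<noteq> 1" "open \<Omega>" "\<Omega> \<noteq> {}"
  obtains A B v c where "A \<in> \<Omega>" "B \<in> \<Omega>" "A \<noteq> B" "v \<noteq> 0" "A *v v = c *\<^sub>R v" "B *v v = c *\<^sub>R v"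
proof -
  obtain A where "A \<in> \<Omega>" using assms by blast
  obtain e where "e > 0" and e: "ball A e \<subseteq> \<Omega>"
    using \<open>open \<Omega>\<close> \<open>A \<in> \<Omega>\<close> openE by blast
  obtain c v where v: "v \<noteq> 0" "A *v v = c *\<^sub>R v"
    using odd_dim_eigenvector [OF assms(1)] by blast
  obtain w where w: "w \<noteq> 0" "w \<bullet> v = 0"
    using exists_nonzero_orthogonal [OF assms(2)] by blast
  define P where "P = outer_prod v w"
  have "P \<noteq> 0" using v w by (simp add: P_def outer_prod_eq_0_iff)
  define s where "s = e / (2 * norm P)"
  have "s > 0" "norm (s *\<^sub>R P) < e"
    using \<open>P \<noteq> 0\<close> \<open>e > 0\<close> by (auto simp: s_def)
  then have "A + s *\<^sub>R P \<in> \<Omega>"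
    by (intro subsetD [OF e]) (simp add: dist_norm)
  moreover have "(A + s *\<^sub>R P) *v v = c *\<^sub>R v"
    using v w by (simp add: P_def matrix_vector_mult_add_rdistrib
        scaleR_matrix_vector_assoc [symmetric] outer_prod_mult_vec)
  ultimately show thesis
    using that [of A "A + s *\<^sub>R P" v c] \<open>A \<in> \<Omega>\<close> v \<open>P \<noteq> 0\<close> \<open>s > 0\<close> by auto
qed

section \<open>Parametrising matrices with a real eigenvector\<close>

definition column_tail :: "'n \<Rightarrow> real^'n^'n \<Rightarrow> real^'n" where
  "column_tail p H = (\<chi> i. if i = p then 0 else H $ i $ p)"

text \<open>
  A correction of column \<open>p\<close> only, polarised to a bilinear map; its value on the diagonal is what turns
  \<open>axis p 1 + column_tail p H\<close> into an eigenvector.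
\<close>
definition eigen_correction :: "'n \<Rightarrow> real^'n^'n \<Rightarrow> real^'n^'n \<Rightarrow> real^'n^'n" where
  "eigen_correction p H K =
     outer_prod (H $ p $ p *\<^sub>R column_tail p K - H *v column_tail p K) (axis p 1)"

text \<open>
  The parameter \<open>0\<close> is sent to the matrix unit at \<open>(p, p)\<close>, whose eigenvalue \<open>1\<close> on \<open>axis p 1\<close> is
  separated from the eigenvalue \<open>0\<close> of the rest. This gap is why the eigenpair depends smoothly on the
  matrix, and why the linear part of the map at \<open>0\<close> is just the identity.
\<close>
definition eigen_param :: "'n \<Rightarrow> real^'n^'n \<Rightarrow> real^'n^'n" where
  "eigen_param p H = outer_prod (axis p 1) (axis p 1) + H + eigen_correction p H H"

text \<open>
  With \<open>y = column_tail p H\<close>, the three summands map \<open>axis p 1 + y\<close> to \<open>axis p 1\<close>,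
  to \<open>H\<^sub>p\<^sub>p axis p 1 + y + H y\<close> and to \<open>H\<^sub>p\<^sub>p y - H y\<close>, respectively.
\<close>
lemma eigen_param_eigenpair:
  "eigen_param p H *v (axis p 1 + column_tail p H)
     = (1 + H $ p $ p) *\<^sub>R (axis p 1 + column_tail p H)"
proof -
  have "axis p 1 \<bullet> (axis p 1 + column_tail p H) = 1"
    by (simp add: inner_axis' column_tail_def)
  moreover have "H *v axis p 1 = H $ p $ p *\<^sub>R axis p 1 + column_tail p H"
    by (simp add: column_tail_def vec_eq_iff if_distrib [of "\<lambda>x. _ * x"] matrix_vector_mult_def axis_def cong: if_cong)
  ultimately show ?thesis
    by (simp add: eigen_param_def eigen_correction_def matrix_vector_mult_add_rdistrib
        outer_prod_mult_vec matrix_vector_right_distrib algebra_simps)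
qed

lemma bounded_bilinear_eigen_correction: "bounded_bilinear (eigen_correction p)"
proof -
  have "column_tail p (K + L) = column_tail p K + column_tail p L"
    "column_tail p (c *\<^sub>R K) = c *\<^sub>R column_tail p K" for K L c
    by (simp_all add: column_tail_def vec_eq_iff)
  then show ?thesis
    unfolding bilinear_conv_bounded_bilinear [symmetric] bilinear_def
    by (auto intro!: linearI simp: eigen_correction_def matrix_vector_right_distrib
        matrix_vector_mult_add_rdistrib matrix_vector_mult_scaleR
        scaleR_matrix_vector_assoc [symmetric]
        algebra_simps simp flip: outer_prod_add outer_prod_scaleR)
qed

text \<open>
  A quadratic map has small Lipschitz constant near \<open>0\<close>, by
  \<open>b H H - b K K = b (H - K) H + b K (H - K)\<close>.
\<close>
lemma bounded_bilinear_diagonal_Lipschitz: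
  fixes b :: "'a::real_normed_vector \<Rightarrow> 'a \<Rightarrow> 'b::real_normed_vector"
  assumes "bounded_bilinear b"
  obtains r where "r > 0"
    "\<And>H K. norm H < r \<Longrightarrow> norm K < r \<Longrightarrow> norm (b H H - b K K) \<le> norm (H - K) / 2"
proof -
  interpret bounded_bilinear b by fact
  obtain M where "M > 0" and M: "\<And>H K. norm (b H K) \<le> norm H * norm K * M"
    using pos_bounded by blast
  show thesis
  proof (rule that [of "1 / (4 * M)"])
    show "0 < 1 / (4 * M)" using \<open>M > 0\<close> by simp
    fix H K :: 'a assume HK: "norm H < 1 / (4 * M)" "norm K < 1 / (4 * M)"
    have "b H H - b K K = b (H - K) H + b K (H - K)"
      by (simp add: diff_left diff_right)
    also have "norm \<dots> \<le> norm (H - K) * norm H * M + norm K * norm (H - K) * M"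
      by (intro norm_triangle_le add_mono M)
    also have "\<dots> = norm (H - K) * (norm H * M + norm K * M)"
      by (simp add: algebra_simps)
    also have "\<dots> \<le> norm (H - K) * (1 / 4 + 1 / 4)"
      using HK \<open>M > 0\<close> by (intro mult_left_mono add_mono) (auto simp: field_simps)
    finally show "norm (b H H - b K K) \<le> norm (H - K) / 2" by simp
  qed
qed

section \<open>Conull sets\<close>

text \<open>
  The preimage is the image of a null set under the inverse of \<open>f\<close>, which exists and is Lipschitz
  by the expansion hypothesis.
\<close>
lemma negligible_expanding_vimage:
  fixes f :: "'a::euclidean_space \<Rightarrow> 'a"
  assumes "negligible N"
    and "\<And>x y. x \<in> S \<Longrightarrow> y \<in> S \<Longrightarrow> norm (x - y) \<le> C * norm (f x - f y)"
  shows "negligible {x \<in> S. f x \<in> N}"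
proof -
  define g where "g = inv_into S f"
  have inj: "inj_on f S"
    using assms(2) by (fastforce intro!: inj_onI)
  have "negligible (g ` (f ` S \<inter> N))"
  proof (rule negligible_locally_Lipschitz_image)
    show "negligible (f ` S \<inter> N)"
      using assms(1) by (rule negligible_subset) auto
    show "\<exists>T B. open T \<and> x \<in> T \<and> (\<forall>y\<in>f ` S \<inter> N \<inter> T. norm (g y - g x) \<le> B * norm (y - x))"
      if "x \<in> f ` S \<inter> N" for x
      using that inj assms(2) by (intro exI [of _ UNIV] exI [of _ C]) (auto simp: g_def)
  qed simp
  moreover have "{x \<in> S. f x \<in> N} \<subseteq> g ` (f ` S \<inter> N)"
    using inj by (force simp: g_def image_iff)
  ultimately show ?thesis by (rule negligible_subset)
qed

lemma conull_common_eigenpair: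
  fixes \<Omega> :: "(real^'n^'n) set"
  assumes "CARD('n) \<noteq> 1" "negligible (UNIV - \<Omega>)"
  obtains A B v c where "A \<in> \<Omega>" "B \<in> \<Omega>" "A \<noteq> B" "v \<noteq> 0" "A *v v = c *\<^sub>R v" "B *v v = c *\<^sub>R v"
proof -
  obtain p q :: 'n where "p \<noteq> q"
    using assms(1) by (metis is_singletonI' is_singleton_altdef UNIV_not_empty)
  obtain r where "r > 0" and r: "\<And>H K :: real^'n^'n. norm H < r \<Longrightarrow> norm K < r \<Longrightarrow>
      norm (eigen_correction p H H - eigen_correction p K K) \<le> norm (H - K) / 2"
    using bounded_bilinear_diagonal_Lipschitz [OF bounded_bilinear_eigen_correction] by blast
  have expand: "norm (H - K) \<le> 2 * norm (eigen_param p H - eigen_param p K)"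
    if "H \<in> ball 0 r" "K \<in> ball 0 r" for H K
  proof -
    have "H - K = (eigen_param p H - eigen_param p K) - (eigen_correction p H H - eigen_correction p K K)"
      by (simp add: eigen_param_def)
    then have "norm (H - K) \<le> norm (eigen_param p H - eigen_param p K) + norm (H - K) / 2"
      using r [of H K] that norm_triangle_ineq4 [of "eigen_param p H - eigen_param p K"
          "eigen_correction p H H - eigen_correction p K K"] by simp
    then show ?thesis by simp
  qed
  define Bad where "Bad = {H \<in> ball 0 r. eigen_param p H \<in> UNIV - \<Omega>}"
  \<comment> \<open>A direction supported in column \<open>q\<close>, hence invisible to the eigenpair read off from column \<open>p\<close>.\<close>
  define E :: "real^'n^'n" where "E = outer_prod (axis p 1) (axis q 1)"
  define D where "D = (r / (2 * norm E)) *\<^sub>R E"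
  have "E \<noteq> 0" by (simp add: E_def outer_prod_eq_0_iff)
  then have "D \<noteq> 0" "norm D = r / 2"
    using \<open>r > 0\<close> by (auto simp: D_def)
  have D_col: "D $ i $ p = 0" for i
    using \<open>p \<noteq> q\<close> by (simp add: D_def E_def outer_prod_def axis_def)
  \<comment> \<open>\<open>H\<close> is sought outside \<open>Bad\<close> and its translate by \<open>- D\<close>, in the ball of half the radius,
    so that \<open>H + D\<close> stays within the ball where \<open>expand\<close> applies.\<close>
  have "negligible Bad"
    unfolding Bad_def using assms(2) expand by (rule negligible_expanding_vimage)
  then have "negligible (Bad \<union> (+) (- D) ` Bad)"
    by (intro negligible_Un negligible_translation)
  moreover have "\<not> negligible (ball (0 :: real^'n^'n) (r / 2))"
    using \<open>r > 0\<close> by (simp add: open_not_negligible)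
  ultimately obtain H where H: "norm H < r / 2" "H \<notin> Bad" "H \<notin> (+) (- D) ` Bad"
    by (metis negligible_subset subsetI UnCI mem_ball_0)
  have "H + D \<notin> Bad"
    using H(3) by (force simp: image_iff)
  have in_ball: "H \<in> ball 0 r" "H + D \<in> ball 0 r"
    using H(1) \<open>norm D = r / 2\<close> norm_triangle_ineq [of H D] \<open>r > 0\<close> by auto
  define v where "v = axis p 1 + column_tail p H"
  show thesis
  proof (rule that)
    show "eigen_param p H \<in> \<Omega>" "eigen_param p (H + D) \<in> \<Omega>"
      using H(2) \<open>H + D \<notin> Bad\<close> in_ball by (auto simp: Bad_def)
    show "eigen_param p H \<noteq> eigen_param p (H + D)"
      using expand [OF in_ball] \<open>D \<noteq> 0\<close> by auto
    have "v $ p = 1" by (simp add: v_def column_tail_def)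
    then show "v \<noteq> 0" by auto
    show "eigen_param p H *v v = (1 + H $ p $ p) *\<^sub>R v"
      unfolding v_def by (rule eigen_param_eigenpair)
    have "column_tail p (H + D) = column_tail p H"
      by (simp add: D_col column_tail_def vec_eq_iff)
    then show "eigen_param p (H + D) *v v = (1 + H $ p $ p) *\<^sub>R v"
      using eigen_param_eigenpair [of p "H + D"] by (simp add: v_def D_col)
  qed
qed

theorem propositionS1:
  fixes T :: real
  assumes "T > 0"
    and "CARD('n::finite) \<noteq> 1"
  shows "(odd CARD('n) \<longrightarrow>
            \<not> (\<exists>\<Omega> :: (real^'n^'n) set.
                 open \<Omega> \<and> \<Omega> \<noteq> {} \<and> unconditionally_identifiable T \<Omega>)) \<and>
         (even CARD('n) \<longrightarrow>
            (\<forall>\<Omega> :: (real^'n^'n) set.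
                 UNIV - \<Omega> \<in> null_sets lebesgue \<longrightarrow> \<not> unconditionally_identifiable T \<Omega>))"
proof (intro conjI impI allI notI)
  assume "odd CARD('n)"
    and "\<exists>\<Omega> :: (real^'n^'n) set. open \<Omega> \<and> \<Omega> \<noteq> {} \<and> unconditionally_identifiable T \<Omega>"
  then show False
    by (metis open_common_eigenpair [OF _ assms(2)] common_eigenpair_not_identifiable)
next
  fix \<Omega> :: "(real^'n^'n) set"
  assume "UNIV - \<Omega> \<in> null_sets lebesgue" and "unconditionally_identifiable T \<Omega>"
  then show False
    by (metis conull_common_eigenpair [OF assms(2)] common_eigenpair_not_identifiable
        negligible_iff_null_sets)
qed

end
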